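(* Let $(\Omega,\Sigma,P)$ be a probability space, let $\sigma\in L^1(0,1)$ be a spectral density, let $\mathcal{R}_\sigma$ be the associated spectral risk measure, and let $Y\in L^\infty$. Then: (i) $$\mathcal{R}_\sigma(Y)=\sup\left\{\mathbb{E}\,YZ\colon Z\in L^1,\ Z\preccurlyeq\sigma\right\}=\sup\left\{\mathbb{E}\,YZ\colon Z\in L^1,\ \mathbb{E}Z=1,\ (1-\alpha)\,\mathrm{AVaR}_\alpha(Z)\le\int_\alpha^1\sigma(p)\,\mathrm{d}p\ \text{ for all } 0\le\alpha<1\right\}.$$ (ii) If the probability space is rich enough to carry a uniformly distributed random variable, then $$\mathcal{R}_\sigma(Y)=\sup\left\{\mathbb{E}\,Y\cdot\sigma(U)\colon U \text{ is uniformly distributed}\right\},$$ where the supremum ranges over random variables $U$ on $\Omega$, and it is attained if $Y$ and $U$ are coupled in a co-monotone way.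
   Context: Probability spaces may have atoms. For a real random variable $Y$, $F_Y^{-1}(\alpha)=\mathrm{VaR}_\alpha(Y):=\inf\{y\colon P(Y\le y)\ge\alpha\}$ is the left-continuous quantile. A spectral density (spectrum) is a non-decreasing function $\sigma\in L^1(0,1)$ with $\sigma\ge 0$ and $\int_0^1\sigma(u)\,\mathrm{d}u=1$. The spectral risk measure with spectrum $\sigma$ is $\mathcal{R}_\sigma(Y):=\int_0^1F_Y^{-1}(\alpha)\,\sigma(\alpha)\,\mathrm{d}\alpha$. For $0\le\alpha<1$, the Average Value-at-Risk is $\mathrm{AVaR}_\alpha(Z):=\frac{1}{1-\alpha}\int_\alpha^1\mathrm{VaR}_p(Z)\,\mathrm{d}p$, and $\mathrm{AVaR}_1(Z):=\lim_{\alpha\nearrow1}\mathrm{AVaR}_\alpha(Z)=\operatorname{ess\,sup}Z$. For a random variable $Z\in L^1$, $Z\preccurlyeq\sigma$ means: $(1-\alpha)\,\mathrm{AVaR}_\alpha(Z)\le\int_\alpha^1\sigma(p)\,\mathrm{d}p$ for all $\alpha\in[0,1]$ (the left-hand side being read as $0$ at $\alpha=1$), and $\mathbb{E}Z=\int_0^1\sigma(p)\,\mathrm{d}p$. $U$ is uniformly distributed if $P(U\le u)=u$ for all $u\in[0,1]$. Random variables $Y$ and $U$ are coupled in a co-monotone way if there is a set $\Omega_0$ of probability one with $(Y(\omega)-Y(\omega'))(U(\omega)-U(\omega'))\ge0$ for all $\omega,\omega'\in\Omega_0$. *)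

theory Defs
  imports "HOL-Probability.Probability"
begin

text \<open>For \<^term>\<open>0 < \<alpha> \<and> \<alpha> < 1\<close> the infimum is over a nonempty set bounded below; the values at the
  other levels are irrelevant, since they only enter integrals over subsets of \<open>(0,1)\<close>.\<close>

definition value_at_risk :: "'a measure \<Rightarrow> ('a \<Rightarrow> real) \<Rightarrow> real \<Rightarrow> real" where
  "value_at_risk M Y \<alpha> = Inf {y. \<alpha> \<le> measure M {\<omega> \<in> space M. Y \<omega> \<le> y}}"

text \<open>A spectrum is a function on \<open>(0,1)\<close>; its values as a function on the reals outside this
  interval are arbitrary (not even measurable) and must never be used. A uniform variable \<open>U\<close> may
  leave \<open>(0,1)\<close> on a null set, so expectations involving \<open>\<sigma> (U \<omega>)\<close> have to be taken over the
  event \<open>U \<in> (0,1)\<close>, which has probability one.\<close>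

definition spectral_density :: "(real \<Rightarrow> real) \<Rightarrow> bool" where
  "spectral_density \<sigma> \<longleftrightarrow>
     mono_on {0<..<1} \<sigma> \<and> (\<forall>u\<in>{0<..<1}. 0 \<le> \<sigma> u) \<and>
     set_integrable lborel {0<..<1} \<sigma> \<and> (LBINT u:{0<..<1}. \<sigma> u) = 1"

definition spectral_risk :: "'a measure \<Rightarrow> (real \<Rightarrow> real) \<Rightarrow> ('a \<Rightarrow> real) \<Rightarrow> real" where
  "spectral_risk M \<sigma> Y = (LBINT \<alpha>:{0<..<1}. value_at_risk M Y \<alpha> * \<sigma> \<alpha>)"

text \<open>Extended-real valued, because the limit at level \<open>1\<close> is the essential supremum, which may
  be infinite.\<close>

definition average_value_at_risk :: "'a measure \<Rightarrow> ('a \<Rightarrow> real) \<Rightarrow> real \<Rightarrow> ereal" where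
  "average_value_at_risk M Z \<alpha> =
     (let avar = (\<lambda>\<beta>. ereal (1 / (1 - \<beta>) * (LBINT p:{\<beta><..<1}. value_at_risk M Z p)))
      in if \<alpha> < 1 then avar \<alpha> else Lim (at_left 1) avar)"

text \<open>At \<^term>\<open>\<alpha> = 1\<close> the left-hand side below is \<open>0\<close>, since \<^term>\<open>0 * (\<infinity>::ereal) = 0\<close>.\<close>

definition dominated_by_spectrum :: "'a measure \<Rightarrow> ('a \<Rightarrow> real) \<Rightarrow> (real \<Rightarrow> real) \<Rightarrow> bool" where
  "dominated_by_spectrum M Z \<sigma> \<longleftrightarrow>
     (\<forall>\<alpha>\<in>{0..1}. ereal (1 - \<alpha>) * average_value_at_risk M Z \<alpha> \<le> ereal (LBINT p:{\<alpha><..<1}. \<sigma> p)) \<and>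
     (LINT \<omega>|M. Z \<omega>) = (LBINT p:{0<..<1}. \<sigma> p)"

definition essentially_bounded :: "'a measure \<Rightarrow> ('a \<Rightarrow> real) \<Rightarrow> bool" where
  "essentially_bounded M Y \<longleftrightarrow> Y \<in> borel_measurable M \<and> (\<exists>C. AE \<omega> in M. \<bar>Y \<omega>\<bar> \<le> C)"

definition uniformly_distributed :: "'a measure \<Rightarrow> ('a \<Rightarrow> real) \<Rightarrow> bool" where
  "uniformly_distributed M U \<longleftrightarrow>
     U \<in> borel_measurable M \<and> (\<forall>u\<in>{0..1}. measure M {\<omega> \<in> space M. U \<omega> \<le> u} = u)"

definition comonotone :: "'a measure \<Rightarrow> ('a \<Rightarrow> real) \<Rightarrow> ('a \<Rightarrow> real) \<Rightarrow> bool" where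
  "comonotone M Y U \<longleftrightarrow>
     (\<exists>\<Omega>\<^sub>0\<in>sets M. measure M \<Omega>\<^sub>0 = 1 \<and>
        (\<forall>\<omega>\<in>\<Omega>\<^sub>0. \<forall>\<omega>'\<in>\<Omega>\<^sub>0. 0 \<le> (Y \<omega> - Y \<omega>') * (U \<omega> - U \<omega>')))"

end

theory Submission
  imports Defs
begin

text \<open>Write \<open>S \<alpha>\<close> for the tail integral of \<open>\<sigma>\<close> over \<open>(\<alpha>, 1)\<close> and suppose that \<open>\<bar>Y\<bar> \<le> C\<close> almost
  surely. The idea is to compare expectations layer by layer. Since \<open>Y\<close> is \<open>-C\<close> plus the integral of
  the indicator of \<open>t < Y\<close> over \<open>t\<close> in \<open>[-C, C]\<close>, for every integrable \<open>Z\<close> of mean one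
  \[ E(Y Z) = \int_{-C}^{C} E(Z; Y > t)\,dt - C. \]
  The quantile function of \<open>Y\<close> on \<open>(0,1)\<close> has the same law as \<open>Y\<close> and exceeds \<open>t\<close> exactly above the
  level \<open>P (Y \<le> t)\<close>, so the same formula, read on \<open>(0,1)\<close>, gives
  \[ R_\sigma(Y) = \int_{-C}^{C} S(P(Y \le t))\,dt - C. \]

  Everything else concerns single layers. The tail integral of a monotone \<open>f\<close> on \<open>(0,1)\<close> is
  \<open>min\<^sub>q ((1 - \<alpha>) q + \<integral> (f - q)\<^sup>+)\<close>, attained at \<open>q = f \<alpha>\<close> if \<open>0 < \<alpha> < 1\<close> (lemmas \<open>tail_integral_le\<close> and
  \<open>tail_integral_mono_eq\<close>). For the quantile function of \<open>Z\<close> this bounds \<open>E (Z; A)\<close> by the tail integral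
  at level \<open>1 - P A\<close>, whence \<open>E (Z; Y > t) \<le> S (P (Y \<le> t))\<close> for every \<open>Z\<close> dominated by \<open>\<sigma>\<close>; this is
  the upper bound \<open>integral_le_spectral_risk\<close>. It also reduces domination by \<open>\<sigma>\<close> to a comparison of
  the expected excesses \<open>E (Z - q)\<^sup>+\<close> (lemma \<open>spectrally_dominatedI\<close>).

  The bound is attained on every probability space, with or without atoms, by \<open>Z = h (Y)\<close>, where
  \<open>h (G)\<close> is the conditional expectation of \<open>\<sigma>\<close> given the quantile function \<open>G\<close> of \<open>Y\<close>: conditioning
  does not increase expected excesses (lemma \<open>spectral_risk_attained\<close>).

  If \<open>U\<close> is uniform, \<open>\<sigma> (U)\<close> has the law of \<open>\<sigma>\<close> and is therefore dominated. If moreover \<open>Y\<close> and \<open>U\<close>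
  are comonotone, the events \<open>Y > t\<close> and \<open>U > P (Y \<le> t)\<close> are nested up to a null set and equally
  likely, hence almost surely equal, and every layer is an equality. To reach the supremum, \<open>Y\<close> is
  approximated from above by \<open>W\<close> with an atomless law, obtained by rounding \<open>Y\<close> to a grid of mesh \<open>e\<close>
  and adding \<open>e\<close> times a uniform variable; no independence is needed. Then \<open>F\<^sub>W (W)\<close> is uniform and
  comonotone with \<open>W\<close>.\<close>

section \<open>The uniform law on the open unit interval\<close>

text \<open>The probability space on which quantile functions and spectra live: the open interval itself, so that
  measurability and integrability do not depend on values outside \<open>(0,1)\<close>.\<close>

abbreviation uniform01 :: "real measure" where
  "uniform01 \<equiv> restrict_space lborel {0<..<1}"

lemma prob_space_uniform01: "prob_space uniform01"
  by (auto simp: emeasure_restrict_space space_restrict_space intro!: prob_spaceI)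

lemma space_uniform01 [simp]: "space uniform01 = {0<..<1}"
  by (simp add: space_restrict_space)

lemma integral_uniform01:
  fixes f :: "real \<Rightarrow> real"
  assumes "0 \<le> \<alpha>"
  shows "(LBINT p:{\<alpha><..<1}. f p) = (LINT p|uniform01. indicator {\<alpha><..} p * f p)"
proof -
  have "(LBINT p:{\<alpha><..<1}. f p) = (LBINT p:{0<..<1}. indicator {\<alpha><..} p * f p)"
    using assms unfolding set_lebesgue_integral_def
    by (intro Bochner_Integration.integral_cong) (auto simp: indicator_def)
  then show ?thesis
    by (simp add: integral_restrict_space set_lebesgue_integral_def)
qed

lemma integral_uniform01_0:
  fixes f :: "real \<Rightarrow> real"
  shows "(LBINT p:{0<..<1}. f p) = (LINT p|uniform01. f p)"
  by (simp add: integral_restrict_space set_lebesgue_integral_def)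

lemma measure_uniform01_greaterThan:
  assumes "0 \<le> \<alpha>" "\<alpha> \<le> 1"
  shows "(LINT p|uniform01. indicator {\<alpha><..} p) = 1 - \<alpha>"
proof -
  have "(LINT p|uniform01. indicator {\<alpha><..} p * (1::real)) = (LBINT p:{\<alpha><..<1}. 1)"
    using integral_uniform01[OF assms(1)] by simp
  also have "\<dots> = 1 - \<alpha>"
    using assms by (simp add: set_lebesgue_integral_def)
  finally show ?thesis by simp
qed

lemma borel_measurable_uniform01_mono:
  fixes f :: "real \<Rightarrow> real"
  assumes "mono_on {0<..<1} f"
  shows "f \<in> borel_measurable uniform01"
proof -
  have "f \<in> borel_measurable (restrict_space borel {0<..<1})"
    by (rule borel_measurable_mono_on_fnc[OF assms])
  moreover have "sets uniform01 = sets (restrict_space borel {0<..<1})"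
    by (intro sets_restrict_space_cong) simp
  ultimately show ?thesis
    using measurable_cong_sets by blast
qed

lemma indicator_measurable_uniform01 [measurable]:
  "A \<in> sets borel \<Longrightarrow> (indicator A :: real \<Rightarrow> real) \<in> borel_measurable uniform01"
  by (intro measurable_restrict_space1) simp

lemma integrable_indicator_mult:
  fixes f :: "'a \<Rightarrow> real"
  assumes "integrable M f" "(indicator A :: 'a \<Rightarrow> real) \<in> borel_measurable M"
  shows "integrable M (\<lambda>x. indicator A x * f x)"
proof (rule Bochner_Integration.integrable_bound[OF assms(1)])
  show "(\<lambda>x. indicator A x * f x) \<in> borel_measurable M"
    using assms by (intro borel_measurable_times) auto
qed (auto simp: indicator_def)

lemma integrable_AE_bounded_mult:
  fixes X W :: "'a \<Rightarrow> real"
  assumes [measurable]: "X \<in> borel_measurable M" and bound: "AE \<omega> in M. \<bar>X \<omega>\<bar> \<le> C"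
    and W: "integrable M W"
  shows "integrable M (\<lambda>\<omega>. X \<omega> * W \<omega>)"
proof (rule Bochner_Integration.integrable_bound)
  have [measurable]: "W \<in> borel_measurable M" using W by auto
  show "integrable M (\<lambda>\<omega>. C * W \<omega>)" using W by simp
  show "AE \<omega> in M. norm (X \<omega> * W \<omega>) \<le> norm (C * W \<omega>)"
    using bound by eventually_elim (auto simp: abs_mult intro!: mult_right_mono)
  show "(\<lambda>\<omega>. X \<omega> * W \<omega>) \<in> borel_measurable M" by measurable
qed

section \<open>The quantile transform\<close>

context prob_space
begin

lemma cdf_distribution_distr:
  assumes "Y \<in> borel_measurable M"
  shows "cdf_distribution (distr M borel Y)"
  unfolding cdf_distribution_def using assms by (rule real_distribution_distr)

lemma cdf_distr_eq:
  assumes "Y \<in> borel_measurable M"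
  shows "cdf (distr M borel Y) y = measure M {\<omega> \<in> space M. Y \<omega> \<le> y}"
  using assms by (auto simp: cdf_def measure_distr intro!: arg_cong[where f = "measure M"])

lemma value_at_risk_eq:
  assumes "Y \<in> borel_measurable M"
  shows "value_at_risk M Y = (\<lambda>p. Inf {y. p \<le> cdf (distr M borel Y) y})"
  by (simp add: value_at_risk_def cdf_distr_eq[OF assms] fun_eq_iff)

lemma value_at_risk_le_iff:
  assumes "Y \<in> borel_measurable M" "0 < p" "p < 1"
  shows "value_at_risk M Y p \<le> y \<longleftrightarrow> p \<le> measure M {\<omega> \<in> space M. Y \<omega> \<le> y}"
proof -
  interpret D: cdf_distribution "distr M borel Y"
    using assms(1) by (rule cdf_distribution_distr)
  show ?thesis
    using D.pseudoinverse[OF assms(2,3), of y]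
    by (simp add: value_at_risk_eq[OF assms(1)] cdf_distr_eq[OF assms(1)])
qed

lemma mono_on_value_at_risk:
  assumes "Y \<in> borel_measurable M"
  shows "mono_on {0<..<1} (value_at_risk M Y)"
proof -
  interpret D: cdf_distribution "distr M borel Y"
    using assms(1) by (rule cdf_distribution_distr)
  show ?thesis
    using D.mono_I by (simp add: value_at_risk_eq[OF assms(1)])
qed

lemmas measurable_value_at_risk = borel_measurable_uniform01_mono[OF mono_on_value_at_risk]

text \<open>The quantile function, as a random variable on \<open>(0,1)\<close>, has the law of \<open>Y\<close>.\<close>

lemma distr_value_at_risk:
  assumes "Y \<in> borel_measurable M"
  shows "distr uniform01 borel (value_at_risk M Y) = distr M borel Y"
proof -
  interpret D: cdf_distribution "distr M borel Y"
    using assms(1) by (rule cdf_distribution_distr)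
  show ?thesis
    using D.distr_I_eq_M by (simp add: value_at_risk_eq[OF assms(1)])
qed

lemma integral_value_at_risk:
  fixes g :: "real \<Rightarrow> real"
  assumes "Y \<in> borel_measurable M" "g \<in> borel_measurable borel"
  shows "(LINT p|uniform01. g (value_at_risk M Y p)) = (LINT \<omega>|M. g (Y \<omega>))"
  using integral_distr[OF measurable_value_at_risk[OF assms(1)] assms(2)]
    integral_distr[OF assms(1) assms(2)] distr_value_at_risk[OF assms(1)] by simp

lemma integrable_value_at_risk:
  fixes g :: "real \<Rightarrow> real"
  assumes "Y \<in> borel_measurable M" "g \<in> borel_measurable borel"
  shows "integrable uniform01 (\<lambda>p. g (value_at_risk M Y p)) \<longleftrightarrow> integrable M (\<lambda>\<omega>. g (Y \<omega>))"
  using integrable_distr_eq[OF measurable_value_at_risk[OF assms(1)] assms(2)]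
    integrable_distr_eq[OF assms(1) assms(2)] distr_value_at_risk[OF assms(1)] by simp

lemma AE_value_at_risk:
  assumes "Y \<in> borel_measurable M" "{x. P x} \<in> sets borel"
  shows "(AE p in uniform01. P (value_at_risk M Y p)) \<longleftrightarrow> (AE \<omega> in M. P (Y \<omega>))"
proof -
  have "{x \<in> space borel. P x} \<in> sets borel"
    using assms(2) by simp
  from AE_distr_iff[OF measurable_value_at_risk[OF assms(1)] this] AE_distr_iff[OF assms(1) this]
  show ?thesis
    unfolding distr_value_at_risk[OF assms(1)] by blast
qed

end

section \<open>Tail integrals and expected excesses\<close>

lemma integrable_excess:
  fixes f :: "'a \<Rightarrow> real"
  assumes "prob_space M" "integrable M f"
  shows "integrable M (\<lambda>x. max (f x - q) 0)"
proof -
  interpret prob_space M by fact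
  show ?thesis using assms(2) by (intro integrable_max) auto
qed

text \<open>Together with the next lemma this is the variational formula of Rockafellar and Uryasev for the
  Average Value-at-Risk.\<close>

lemma tail_integral_le:
  fixes f :: "real \<Rightarrow> real"
  assumes f: "integrable uniform01 f" and \<alpha>: "0 \<le> \<alpha>" "\<alpha> \<le> 1"
  shows "(LINT p|uniform01. indicator {\<alpha><..} p * f p)
         \<le> (1 - \<alpha>) * q + (LINT p|uniform01. max (f p - q) 0)"
proof -
  interpret U: prob_space uniform01 by (rule prob_space_uniform01)
  note ex = integrable_excess[OF prob_space_uniform01 f]
  have i1: "integrable uniform01 (\<lambda>p. indicator {\<alpha><..} p * q)"
    by (intro integrable_indicator_mult) auto
  have "(LINT p|uniform01. indicator {\<alpha><..} p * f p)
        \<le> (LINT p|uniform01. indicator {\<alpha><..} p * q + max (f p - q) 0)"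
    using f i1 ex by (intro integral_mono integrable_indicator_mult Bochner_Integration.integrable_add)
                  (auto simp: indicator_def)
  also have "\<dots> = (1 - \<alpha>) * q + (LINT p|uniform01. max (f p - q) 0)"
    using i1 ex measure_uniform01_greaterThan[OF \<alpha>] by simp
  finally show ?thesis .
qed

lemma tail_integral_mono_eq:
  fixes f :: "real \<Rightarrow> real"
  assumes f: "integrable uniform01 f" and mono: "mono_on {0<..<1} f" and \<alpha>: "0 < \<alpha>" "\<alpha> < 1"
  shows "(LINT p|uniform01. indicator {\<alpha><..} p * f p)
         = (1 - \<alpha>) * f \<alpha> + (LINT p|uniform01. max (f p - f \<alpha>) 0)"
proof -
  interpret U: prob_space uniform01 by (rule prob_space_uniform01)
  note ex = integrable_excess[OF prob_space_uniform01 f]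
  have i1: "integrable uniform01 (\<lambda>p. indicator {\<alpha><..} p * f \<alpha>)"
    by (intro integrable_indicator_mult) auto
  have "(LINT p|uniform01. indicator {\<alpha><..} p * f p)
        = (LINT p|uniform01. indicator {\<alpha><..} p * f \<alpha> + max (f p - f \<alpha>) 0)"
  proof (intro Bochner_Integration.integral_cong refl)
    fix p assume "p \<in> space uniform01"
    then have "\<alpha> < p \<Longrightarrow> f \<alpha> \<le> f p" "\<not> \<alpha> < p \<Longrightarrow> f p \<le> f \<alpha>"
      using mono \<alpha> by (auto simp: mono_on_def)
    then show "indicator {\<alpha><..} p * f p = indicator {\<alpha><..} p * f \<alpha> + max (f p - f \<alpha>) 0"
      by (auto simp: indicator_def max_def)
  qed
  also have "\<dots> = (1 - \<alpha>) * f \<alpha> + (LINT p|uniform01. max (f p - f \<alpha>) 0)"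
    using i1 ex measure_uniform01_greaterThan[of \<alpha>] \<alpha> by simp
  finally show ?thesis .
qed

context prob_space
begin

text \<open>A random variable whose expected excesses are bounded by those of a monotone function \<open>f\<close> with
  the same mean has smaller tail integrals: bound the left-hand side with \<open>q = f \<alpha>\<close>, for which the
  formula is exact on the right. Level \<open>0\<close> lies outside the domain of \<open>f\<close> and is covered by the
  equality of the means.\<close>

lemma tail_value_at_risk_le_tail:
  fixes Z :: "'a \<Rightarrow> real" and f :: "real \<Rightarrow> real"
  assumes Z: "integrable M Z"
    and f: "integrable uniform01 f" and mono: "mono_on {0<..<1} f"
    and mean: "(LINT \<omega>|M. Z \<omega>) = (LINT p|uniform01. f p)"
    and excess: "\<And>q. (LINT \<omega>|M. max (Z \<omega> - q) 0) \<le> (LINT p|uniform01. max (f p - q) 0)"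
    and \<alpha>: "0 \<le> \<alpha>" "\<alpha> < 1"
  shows "(LINT p|uniform01. indicator {\<alpha><..} p * value_at_risk M Z p)
         \<le> (LINT p|uniform01. indicator {\<alpha><..} p * f p)"
proof (cases "\<alpha> = 0")
  case True
  have Zm: "Z \<in> borel_measurable M" using Z by auto
  have *: "(LINT p|uniform01. indicator {0<..} p * g p) = (LINT p|uniform01. g p)" for g :: "real \<Rightarrow> real"
    by (intro Bochner_Integration.integral_cong) auto
  show ?thesis
    using integral_value_at_risk[OF Zm, of "\<lambda>x. x"] mean by (simp add: True *)
next
  case False
  then have \<alpha>': "0 < \<alpha>" using \<alpha> by simp
  have Zm: "Z \<in> borel_measurable M" using Z by auto
  have "integrable uniform01 (value_at_risk M Z)"
    using integrable_value_at_risk[OF Zm, of "\<lambda>x. x"] Z by simp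
  then have "(LINT p|uniform01. indicator {\<alpha><..} p * value_at_risk M Z p)
      \<le> (1 - \<alpha>) * f \<alpha> + (LINT p|uniform01. max (value_at_risk M Z p - f \<alpha>) 0)"
    using \<alpha> by (intro tail_integral_le) auto
  also have "(LINT p|uniform01. max (value_at_risk M Z p - f \<alpha>) 0) = (LINT \<omega>|M. max (Z \<omega> - f \<alpha>) 0)"
    by (rule integral_value_at_risk[OF Zm]) simp
  also have "(1 - \<alpha>) * f \<alpha> + \<dots> \<le> (1 - \<alpha>) * f \<alpha> + (LINT p|uniform01. max (f p - f \<alpha>) 0)"
    using excess by simp
  also have "\<dots> = (LINT p|uniform01. indicator {\<alpha><..} p * f p)"
    using tail_integral_mono_eq[OF f mono \<alpha>' \<alpha>(2)] by simp
  finally show ?thesis .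
qed

text \<open>Among events of a given probability, the integral of \<open>Z\<close> is largest on its upper tail. The
  right-hand side is evaluated on \<open>(0,1)\<close>, where no atom of \<open>Z\<close> can obstruct the choice of a tail.\<close>

lemma integral_event_le_tail_value_at_risk:
  fixes Z :: "'a \<Rightarrow> real"
  assumes Z: "integrable M Z" and A: "A \<in> events" and pos: "0 < prob A" "prob A < 1"
  shows "(LINT \<omega>|M. indicator A \<omega> * Z \<omega>)
         \<le> (LINT p|uniform01. indicator {1 - prob A<..} p * value_at_risk M Z p)"
proof -
  have Zm: "Z \<in> borel_measurable M" using Z by auto
  define q where "q = value_at_risk M Z (1 - prob A)"
  note ex = integrable_excess[OF prob_space_axioms Z]
  have i1: "integrable M (\<lambda>\<omega>. indicator A \<omega> * q)"
    using A by (intro integrable_indicator_mult) auto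
  have "(LINT \<omega>|M. indicator A \<omega> * Z \<omega>) \<le> (LINT \<omega>|M. indicator A \<omega> * q + max (Z \<omega> - q) 0)"
    using Z i1 ex A by (intro integral_mono integrable_indicator_mult Bochner_Integration.integrable_add)
                  (auto simp: indicator_def)
  also have "\<dots> = prob A * q + (LINT \<omega>|M. max (Z \<omega> - q) 0)"
    using i1 ex A by simp
  also have "(LINT \<omega>|M. max (Z \<omega> - q) 0) = (LINT p|uniform01. max (value_at_risk M Z p - q) 0)"
    by (rule integral_value_at_risk[OF Zm, symmetric]) simp
  also have "prob A * q + \<dots> = (LINT p|uniform01. indicator {1 - prob A<..} p * value_at_risk M Z p)"
    using tail_integral_mono_eq[OF _ mono_on_value_at_risk[OF Zm], of "1 - prob A"] pos
      integrable_value_at_risk[OF Zm, of "\<lambda>x. x"] Z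
    by (simp add: q_def)
  finally show ?thesis .
qed

section \<open>Layer-wise computation of expectations of products\<close>

text \<open>For \<open>\<bar>X\<bar> \<le> C\<close>, integrating the indicator of \<open>t < X\<close> over \<open>t\<close> in \<open>[-C, C]\<close> gives \<open>X + C\<close>; multiply
  by \<open>W\<close> and exchange the integrals.\<close>

lemma integral_mult_layers:
  fixes X W :: "'a \<Rightarrow> real"
  assumes X[measurable]: "X \<in> borel_measurable M" and bound: "AE \<omega> in M. \<bar>X \<omega>\<bar> \<le> C"
    and W: "integrable M W"
  shows "integrable lborel (\<lambda>t. indicator {-C..C} t * (LINT \<omega>|M. indicator {\<omega>. t < X \<omega>} \<omega> * W \<omega>))"
    and "(LINT \<omega>|M. X \<omega> * W \<omega>) = (LINT t|lborel. indicator {-C..C} t *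
             (LINT \<omega>|M. indicator {\<omega>. t < X \<omega>} \<omega> * W \<omega>)) - C * (LINT \<omega>|M. W \<omega>)"
proof -
  have C: "0 \<le> C"
  proof (rule ccontr)
    assume "\<not> 0 \<le> C"
    then have "AE \<omega> in M. False" using bound by (rule_tac AE_mp[OF bound]) auto
    then show False by (simp add: AE_iff_measurable) 
  qed
  have Wm[measurable]: "W \<in> borel_measurable M" using W by auto
  interpret P: pair_sigma_finite M lborel by standard
  define f :: "'a \<Rightarrow> real \<Rightarrow> real" where
    "f \<omega> t = indicator {-C..C} t * (indicator {\<omega>. t < X \<omega>} \<omega> * W \<omega>)" for \<omega> t
  have f_alt: "f = (\<lambda>\<omega> t. indicator {-C..C} t * ((if t < X \<omega> then 1 else 0) * W \<omega>))"
    by (auto simp: f_def fun_eq_iff indicator_def)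
  have fm[measurable]: "case_prod f \<in> borel_measurable (M \<Otimes>\<^sub>M lborel)"
    unfolding f_alt by measurable
  have ind: "integrable lborel (\<lambda>t. indicator {-C..C} t * w)" for w :: real
    by (intro integrable_mult_left integrable_real_indicator) (simp_all add: emeasure_lborel_Icc_eq)
  have int_f: "integrable (M \<Otimes>\<^sub>M lborel) (case_prod f)"
  proof (rule Bochner_Integration.integrable_bound)
    show "integrable (M \<Otimes>\<^sub>M lborel) (\<lambda>(\<omega>, t). W \<omega> * indicator {-C..C} t)"
    proof (rule P.Fubini_integrable)
      show "AE \<omega> in M. integrable lborel (\<lambda>t. case (\<omega>, t) of (\<omega>, t) \<Rightarrow> W \<omega> * indicator {-C..C} t)"
        using ind by (simp add: mult.commute)
      have "(\<lambda>\<omega>. LINT t|lborel. norm (case (\<omega>, t) of (\<omega>, t) \<Rightarrow> W \<omega> * indicator {-C..C} t)) =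
            (\<lambda>\<omega>. \<bar>W \<omega>\<bar> * (2 * C))"
        using C by (simp add: abs_mult fun_eq_iff)
      then show "integrable M (\<lambda>\<omega>. LINT t|lborel. norm (case (\<omega>, t) of (\<omega>, t) \<Rightarrow> W \<omega> * indicator {-C..C} t))"
        using W by simp
    qed measurable
  qed (auto simp: f_def indicator_def abs_mult)
  have snd: "(LINT \<omega>|M. f \<omega> t) = indicator {-C..C} t * (LINT \<omega>|M. indicator {\<omega>. t < X \<omega>} \<omega> * W \<omega>)" for t
    unfolding f_def by simp
  have "integrable lborel (\<lambda>t. LINT \<omega>|M. f \<omega> t)"
    by (rule P.integrable_snd[OF int_f])
  then show "integrable lborel (\<lambda>t. indicator {-C..C} t * (LINT \<omega>|M. indicator {\<omega>. t < X \<omega>} \<omega> * W \<omega>))"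
    unfolding snd .
  have "(LINT t|lborel. LINT \<omega>|M. f \<omega> t) = (LINT \<omega>|M. LINT t|lborel. f \<omega> t)"
    by (rule P.Fubini_integral[OF int_f])
  also have "\<dots> = (LINT \<omega>|M. X \<omega> * W \<omega> + C * W \<omega>)"
  proof (rule integral_cong_AE)
    show "(\<lambda>\<omega>. LINT t|lborel. f \<omega> t) \<in> borel_measurable M"
      by measurable
    show "AE \<omega> in M. (LINT t|lborel. f \<omega> t) = X \<omega> * W \<omega> + C * W \<omega>"
      using bound
    proof eventually_elim
      fix \<omega> assume b: "\<bar>X \<omega>\<bar> \<le> C"
      have "(LINT t|lborel. f \<omega> t) = (LINT t|lborel. indicator {-C..<X \<omega>} t * W \<omega>)"
        using b by (intro Bochner_Integration.integral_cong) (auto simp: f_def indicator_def)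
      also have "\<dots> = (X \<omega> + C) * W \<omega>" using b by simp
      finally show "(LINT t|lborel. f \<omega> t) = X \<omega> * W \<omega> + C * W \<omega>" by (simp add: algebra_simps)
    qed
  qed measurable
  also have "\<dots> = (LINT \<omega>|M. X \<omega> * W \<omega>) + C * (LINT \<omega>|M. W \<omega>)"
  proof -
    have "integrable M (\<lambda>\<omega>. X \<omega> * W \<omega>)"
      by (rule integrable_AE_bounded_mult[OF X bound W])
    then show ?thesis using W by simp
  qed
  finally show "(LINT \<omega>|M. X \<omega> * W \<omega>) = (LINT t|lborel. indicator {-C..C} t *
             (LINT \<omega>|M. indicator {\<omega>. t < X \<omega>} \<omega> * W \<omega>)) - C * (LINT \<omega>|M. W \<omega>)"
    unfolding snd by simp
qed

end

section \<open>Domination by a spectrum\<close>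

lemma spectral_densityD:
  assumes "spectral_density \<sigma>"
  shows "mono_on {0<..<1} \<sigma>" "\<And>p. 0 < p \<Longrightarrow> p < 1 \<Longrightarrow> 0 \<le> \<sigma> p"
    "integrable uniform01 \<sigma>" "(LINT p|uniform01. \<sigma> p) = 1"
  using assms unfolding spectral_density_def integral_uniform01_0
  by (auto simp: integrable_restrict_space set_integrable_def)

text \<open>Domination by a spectrum with all tail integrals taken over \<open>uniform01\<close>, the mean normalised to
  one, and without the trivial level \<open>\<alpha> = 1\<close>. For a spectral density it describes both feasible
  sets of the dual representation.\<close>

definition spectrally_dominated :: "'a measure \<Rightarrow> (real \<Rightarrow> real) \<Rightarrow> ('a \<Rightarrow> real) \<Rightarrow> bool" where
  "spectrally_dominated M \<sigma> Z \<longleftrightarrow> integrable M Z \<and> (LINT \<omega>|M. Z \<omega>) = 1 \<and>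
     (\<forall>\<alpha>\<in>{0..<1}. (LINT p|uniform01. indicator {\<alpha><..} p * value_at_risk M Z p)
        \<le> (LINT p|uniform01. indicator {\<alpha><..} p * \<sigma> p))"

lemma average_value_at_risk_le_iff:
  assumes "0 \<le> \<alpha>" "\<alpha> < 1"
  shows "ereal (1 - \<alpha>) * average_value_at_risk M Z \<alpha> \<le> ereal (LBINT p:{\<alpha><..<1}. \<sigma> p) \<longleftrightarrow>
    (LINT p|uniform01. indicator {\<alpha><..} p * value_at_risk M Z p)
        \<le> (LINT p|uniform01. indicator {\<alpha><..} p * \<sigma> p)"
  using assms by (simp add: average_value_at_risk_def integral_uniform01)

lemma spectrally_dominated_iff:
  "spectrally_dominated M \<sigma> Z \<longleftrightarrow> integrable M Z \<and> (LINT \<omega>|M. Z \<omega>) = 1 \<and>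
     (\<forall>\<alpha>\<in>{0..<1}. ereal (1 - \<alpha>) * average_value_at_risk M Z \<alpha> \<le> ereal (LBINT p:{\<alpha><..<1}. \<sigma> p))"
  by (auto simp: spectrally_dominated_def average_value_at_risk_le_iff)

lemma spectrally_dominated_iff_dominated_by_spectrum:
  assumes "spectral_density \<sigma>"
  shows "spectrally_dominated M \<sigma> Z \<longleftrightarrow> integrable M Z \<and> dominated_by_spectrum M Z \<sigma>"
proof -
  have "{0..1} = insert 1 {0..<1::real}" by auto
  \<comment> \<open>The product vanishes even when the essential supremum is infinite.\<close>
  moreover have "ereal (1 - 1) * average_value_at_risk M Z 1 \<le> ereal (LBINT p:{1<..<1}. \<sigma> p)"
    by (simp add: set_lebesgue_integral_def flip: zero_ereal_def)
  ultimately show ?thesis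
    using spectral_densityD(4)[OF assms]
    unfolding spectrally_dominated_iff dominated_by_spectrum_def integral_uniform01_0
    by auto
qed

context prob_space
begin

lemma spectrally_dominatedI:
  assumes \<sigma>: "spectral_density \<sigma>" and Z: "integrable M Z" "(LINT \<omega>|M. Z \<omega>) = 1"
    and "\<And>q. (LINT \<omega>|M. max (Z \<omega> - q) 0) \<le> (LINT p|uniform01. max (\<sigma> p - q) 0)"
  shows "spectrally_dominated M \<sigma> Z"
  unfolding spectrally_dominated_def
  using tail_value_at_risk_le_tail[OF Z(1) spectral_densityD(3,1)[OF \<sigma>]]
    spectral_densityD(4)[OF \<sigma>] Z assms(4) by auto

lemma integral_event_le_tail_spectrum:
  assumes \<sigma>: "spectral_density \<sigma>" and Z: "spectrally_dominated M \<sigma> Z" and A: "A \<in> events"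
  shows "(LINT \<omega>|M. indicator A \<omega> * Z \<omega>) \<le> (LINT p|uniform01. indicator {1 - prob A<..} p * \<sigma> p)"
proof -
  have Zi: "integrable M Z" "(LINT \<omega>|M. Z \<omega>) = 1"
    using Z by (auto simp: spectrally_dominated_def)
  have [measurable]: "Z \<in> borel_measurable M" using Zi by auto
  consider "prob A = 0" | "prob A = 1" | "0 < prob A" "prob A < 1"
    using measure_nonneg[of M A] prob_le_1[of A] by linarith
  then show ?thesis
  proof cases
    case 1
    then have "AE \<omega> in M. indicator A \<omega> * Z \<omega> = 0"
      using A prob_eq_0[OF A] by (auto simp: indicator_def)
    then have "(LINT \<omega>|M. indicator A \<omega> * Z \<omega>) = 0"
      by (rule integral_eq_zero_AE)
    moreover have "(LINT p|uniform01. indicator {1<..} p * \<sigma> p) = (LINT p|uniform01. 0)"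
      by (intro Bochner_Integration.integral_cong) auto
    ultimately show ?thesis using 1 by simp
  next
    case 2
    then have "AE \<omega> in M. \<omega> \<in> A" using A by (simp add: prob_eq_1)
    then have "(LINT \<omega>|M. indicator A \<omega> * Z \<omega>) = (LINT \<omega>|M. Z \<omega>)"
      using A by (intro integral_cong_AE) auto
    moreover have "(LINT p|uniform01. indicator {0<..} p * \<sigma> p) = (LINT p|uniform01. \<sigma> p)"
      by (intro Bochner_Integration.integral_cong) auto
    ultimately show ?thesis using 2 Zi spectral_densityD(4)[OF \<sigma>] by simp
  next
    case 3
    have "(LINT \<omega>|M. indicator A \<omega> * Z \<omega>)
        \<le> (LINT p|uniform01. indicator {1 - prob A<..} p * value_at_risk M Z p)"
      by (rule integral_event_le_tail_value_at_risk[OF Zi(1) A 3])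
    also have "\<dots> \<le> (LINT p|uniform01. indicator {1 - prob A<..} p * \<sigma> p)"
      using Z 3 by (auto simp: spectrally_dominated_def)
    finally show ?thesis .
  qed
qed

section \<open>The upper bound\<close>

lemma prob_le_eq_compl_greater:
  fixes Y :: "'a \<Rightarrow> real"
  assumes [measurable]: "Y \<in> borel_measurable M"
  shows "measure M {\<omega> \<in> space M. Y \<omega> \<le> t} = 1 - prob {\<omega> \<in> space M. t < Y \<omega>}"
proof -
  have "{\<omega> \<in> space M. Y \<omega> \<le> t} = space M - {\<omega> \<in> space M. t < Y \<omega>}" by auto
  then show ?thesis by (simp add: prob_compl)
qed

lemma AE_bounded_value_at_risk:
  assumes "Y \<in> borel_measurable M" "AE \<omega> in M. \<bar>Y \<omega>\<bar> \<le> C"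
  shows "AE p in uniform01. \<bar>value_at_risk M Y p\<bar> \<le> C"
proof -
  have "{x::real. \<bar>x\<bar> \<le> C} \<in> sets borel" by measurable
  from AE_value_at_risk[OF assms(1) this] show ?thesis using assms(2) by simp
qed

text \<open>The layer formula for the quantile function of \<open>Y\<close> and the weight \<open>\<sigma>\<close>.\<close>

lemma spectral_risk_layers:
  assumes \<sigma>: "spectral_density \<sigma>" and Y: "Y \<in> borel_measurable M" "AE \<omega> in M. \<bar>Y \<omega>\<bar> \<le> C"
  defines "S \<equiv> \<lambda>t. LINT p|uniform01. indicator {1 - prob {\<omega> \<in> space M. t < Y \<omega>}<..} p * \<sigma> p"
  shows "integrable lborel (\<lambda>t. indicator {-C..C} t * S t)"
    and "spectral_risk M \<sigma> Y = (LINT t|lborel. indicator {-C..C} t * S t) - C"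
proof -
  have eq: "(LINT p|uniform01. indicator {p. t < value_at_risk M Y p} p * \<sigma> p) = S t" for t
    unfolding S_def
  proof (intro Bochner_Integration.integral_cong refl)
    fix p assume "p \<in> space uniform01"
    then have "t < value_at_risk M Y p \<longleftrightarrow> 1 - prob {\<omega> \<in> space M. t < Y \<omega>} < p"
      using value_at_risk_le_iff[OF Y(1), of p t] prob_le_eq_compl_greater[OF Y(1), of t]
      by (auto simp flip: not_le)
    then show "indicator {p. t < value_at_risk M Y p} p * \<sigma> p =
        indicator {1 - prob {\<omega> \<in> space M. t < Y \<omega>}<..} p * \<sigma> p"
      by (simp add: indicator_def)
  qed
  note L = prob_space.integral_mult_layers[OF prob_space_uniform01 measurable_value_at_risk[OF Y(1)]
      AE_bounded_value_at_risk[OF Y] spectral_densityD(3)[OF \<sigma>], unfolded eq]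
  show "integrable lborel (\<lambda>t. indicator {-C..C} t * S t)" by (rule L(1))
  show "spectral_risk M \<sigma> Y = (LINT t|lborel. indicator {-C..C} t * S t) - C"
    using L(2) spectral_densityD(4)[OF \<sigma>] by (simp add: spectral_risk_def integral_uniform01_0)
qed

lemma integral_indicator_event:
  "(LINT \<omega>|M. indicator {\<omega>. P \<omega>} \<omega> * Z \<omega>) = (LINT \<omega>|M. indicator {\<omega> \<in> space M. P \<omega>} \<omega> * (Z \<omega> :: real))"
  by (intro Bochner_Integration.integral_cong) (auto simp: indicator_def)

lemma integral_le_spectral_risk:
  assumes \<sigma>: "spectral_density \<sigma>" and Y: "essentially_bounded M Y"
    and Z: "spectrally_dominated M \<sigma> Z"
  shows "(LINT \<omega>|M. Y \<omega> * Z \<omega>) \<le> spectral_risk M \<sigma> Y"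
proof -
  obtain C where Y: "Y \<in> borel_measurable M" "AE \<omega> in M. \<bar>Y \<omega>\<bar> \<le> C"
    using Y by (auto simp: essentially_bounded_def)
  note [measurable] = Y(1)
  have Zi: "integrable M Z" "(LINT \<omega>|M. Z \<omega>) = 1"
    using Z by (auto simp: spectrally_dominated_def)
  note L = integral_mult_layers[OF Y Zi(1)] and R = spectral_risk_layers[OF \<sigma> Y]
  have le: "(LINT \<omega>|M. indicator {\<omega>. t < Y \<omega>} \<omega> * Z \<omega>) \<le>
      (LINT p|uniform01. indicator {1 - prob {\<omega> \<in> space M. t < Y \<omega>}<..} p * \<sigma> p)" for t
    by (subst integral_indicator_event, rule integral_event_le_tail_spectrum[OF \<sigma> Z]) measurable
  have "(LINT t|lborel. indicator {-C..C} t * (LINT \<omega>|M. indicator {\<omega>. t < Y \<omega>} \<omega> * Z \<omega>)) \<le>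
      (LINT t|lborel. indicator {-C..C} t *
        (LINT p|uniform01. indicator {1 - prob {\<omega> \<in> space M. t < Y \<omega>}<..} p * \<sigma> p))"
    by (rule integral_mono[OF L(1) R(1)]) (rule mult_left_mono[OF le], simp)
  then show ?thesis
    unfolding L(2) R(2) Zi(2) by simp
qed

text \<open>Equality in every layer gives equality in the upper bound.\<close>

lemma integral_eq_spectral_riskI:
  assumes \<sigma>: "spectral_density \<sigma>" and Y: "essentially_bounded M Y"
    and Z: "integrable M Z" "(LINT \<omega>|M. Z \<omega>) = 1"
    and tail: "\<And>t. (LINT \<omega>|M. indicator {\<omega> \<in> space M. t < Y \<omega>} \<omega> * Z \<omega>)
         = (LINT p|uniform01. indicator {1 - prob {\<omega> \<in> space M. t < Y \<omega>}<..} p * \<sigma> p)"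
  shows "(LINT \<omega>|M. Y \<omega> * Z \<omega>) = spectral_risk M \<sigma> Y"
proof -
  obtain C where Y: "Y \<in> borel_measurable M" "AE \<omega> in M. \<bar>Y \<omega>\<bar> \<le> C"
    using Y by (auto simp: essentially_bounded_def)
  show ?thesis
    unfolding integral_mult_layers(2)[OF Y Z(1)] spectral_risk_layers(2)[OF \<sigma> Y]
      trans[OF integral_indicator_event tail] Z(2) by simp
qed

section \<open>Attainment on an arbitrary probability space\<close>

text \<open>A version of the conditional expectation of \<open>\<sigma>\<close> given the quantile function of \<open>Y\<close>, as a function
  \<open>h\<close> on the line. It is the density, with respect to the law \<open>\<mu>\<close> of \<open>Y\<close>, of the image \<open>\<nu>\<close> of the
  measure with density \<open>\<sigma>\<close> on \<open>(0,1)\<close> under the quantile function.\<close>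

lemma spectrum_conditional_expectation:
  assumes \<sigma>: "spectral_density \<sigma>" and Y: "Y \<in> borel_measurable M"
  obtains h :: "real \<Rightarrow> real" where "h \<in> borel_measurable borel"
    and "\<And>g. g \<in> borel_measurable borel \<Longrightarrow>
      integrable M (\<lambda>\<omega>. h (Y \<omega>) * g (Y \<omega>)) \<longleftrightarrow> integrable uniform01 (\<lambda>p. \<sigma> p * g (value_at_risk M Y p))"
    and "\<And>g. g \<in> borel_measurable borel \<Longrightarrow>
      (LINT \<omega>|M. h (Y \<omega>) * g (Y \<omega>)) = (LINT p|uniform01. \<sigma> p * g (value_at_risk M Y p))"
proof -
  define G where "G = value_at_risk M Y"
  have Gm[measurable]: "G \<in> borel_measurable uniform01"
    unfolding G_def by (rule measurable_value_at_risk[OF Y])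
  have \<sigma>m[measurable]: "\<sigma> \<in> borel_measurable uniform01"
    using spectral_densityD(3)[OF \<sigma>] by auto
  define \<mu> where "\<mu> = distr M borel Y"
  define \<nu> where "\<nu> = distr (density uniform01 \<sigma>) borel G"
  interpret \<mu>: prob_space \<mu>
    unfolding \<mu>_def by (rule prob_space_distr[OF Y])
  have \<mu>_G: "\<mu> = distr uniform01 borel G"
    unfolding \<mu>_def G_def by (rule distr_value_at_risk[OF Y, symmetric])
  have sets_\<mu>[measurable_cong]: "sets \<mu> = sets borel" and sets_\<nu>[measurable_cong]: "sets \<nu> = sets borel"
    by (simp_all add: \<mu>_def \<nu>_def)
  have \<sigma>_nonneg: "AE p in uniform01. 0 \<le> \<sigma> p"
    using spectral_densityD(2)[OF \<sigma>] by (intro AE_I2) auto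
  have "emeasure \<nu> (space \<nu>) = (\<integral>\<^sup>+p. ennreal (\<sigma> p) \<partial>uniform01)"
  proof -
    have "emeasure \<nu> (space \<nu>) = emeasure (density uniform01 \<sigma>) (space (density uniform01 \<sigma>))"
      unfolding \<nu>_def by (subst emeasure_distr) auto
    also have "\<dots> = (\<integral>\<^sup>+p. ennreal (\<sigma> p) * indicator (space uniform01) p \<partial>uniform01)"
      unfolding space_density by (rule emeasure_density[OF measurable_compose[OF \<sigma>m measurable_ennreal] sets.top])
    also have "\<dots> = (\<integral>\<^sup>+p. ennreal (\<sigma> p) \<partial>uniform01)"
      by (intro nn_integral_cong) simp
    finally show ?thesis .
  qed
  also have "\<dots> = 1"
    using nn_integral_eq_integral[OF spectral_densityD(3)[OF \<sigma>] \<sigma>_nonneg] spectral_densityD(4)[OF \<sigma>]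
    by simp
  finally have \<nu>_space: "emeasure \<nu> (space \<nu>) = 1" .
  have "absolutely_continuous \<mu> \<nu>"
    unfolding absolutely_continuous_def
  proof
    fix N assume "N \<in> null_sets \<mu>"
    then have N: "N \<in> sets borel" "emeasure uniform01 (G -` N \<inter> space uniform01) = 0"
      by (auto simp: \<mu>_G null_sets_def emeasure_distr)
    then have "G -` N \<inter> space uniform01 \<in> null_sets uniform01"
      using measurable_sets[OF Gm N(1)] by auto
    then have "AE p in uniform01. p \<notin> G -` N \<inter> space uniform01"
      by (rule AE_not_in)
    then have "AE p in uniform01. p \<in> G -` N \<inter> space uniform01 \<longrightarrow> ennreal (\<sigma> p) = 0"
      by eventually_elim blast
    then have "G -` N \<inter> space uniform01 \<in> null_sets (density uniform01 \<sigma>)"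
      using measurable_sets[OF Gm N(1)] by (subst null_sets_density_iff) simp_all
    then show "N \<in> null_sets \<nu>"
      using N(1) by (auto simp: \<nu>_def null_sets_def emeasure_distr)
  qed
  then obtain h0 where h0: "h0 \<in> borel_measurable \<mu>" "density \<mu> h0 = \<nu>"
    using \<mu>.Radon_Nikodym[of \<nu>] sets_\<mu> sets_\<nu> by auto
  have h0m[measurable]: "h0 \<in> borel_measurable borel" using h0(1) by simp
  define h where "h = (\<lambda>y. enn2real (h0 y))"
  have hm[measurable]: "h \<in> borel_measurable borel" unfolding h_def by measurable
  have "(\<integral>\<^sup>+y. h0 y \<partial>\<mu>) = emeasure \<nu> (space \<nu>)"
    unfolding h0(2)[symmetric] by (simp add: emeasure_density cong: nn_integral_cong_simp)
  then have "(\<integral>\<^sup>+y. h0 y \<partial>\<mu>) \<noteq> \<infinity>" using \<nu>_space by simp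
  then have "AE y in \<mu>. h0 y \<noteq> \<infinity>" using h0(1) by (rule nn_integral_PInf_AE[rotated])
  then have "AE y in \<mu>. h0 y = ennreal (h y)"
    by eventually_elim (auto simp: h_def less_top)
  then have "density \<mu> h0 = density \<mu> h"
    by (intro density_cong) auto
  with h0 have \<nu>: "\<nu> = density \<mu> h" by simp
  have h_nonneg: "AE y in \<mu>. 0 \<le> h y" by (simp add: h_def)
  show ?thesis
  proof
    show "h \<in> borel_measurable borel" by fact
    fix g :: "real \<Rightarrow> real" assume g[measurable]: "g \<in> borel_measurable borel"
    have "integrable M (\<lambda>\<omega>. h (Y \<omega>) * g (Y \<omega>)) \<longleftrightarrow> integrable \<mu> (\<lambda>y. h y * g y)"
      unfolding \<mu>_def using Y by (subst integrable_distr_eq) auto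
    also have "\<dots> \<longleftrightarrow> integrable \<nu> g"
      unfolding \<nu> using h_nonneg by (subst integrable_density) auto
    also have "\<dots> \<longleftrightarrow> integrable (density uniform01 \<sigma>) (\<lambda>p. g (G p))"
      unfolding \<nu>_def by (subst integrable_distr_eq) auto
    also have "\<dots> \<longleftrightarrow> integrable uniform01 (\<lambda>p. \<sigma> p * g (G p))"
      using \<sigma>_nonneg by (subst integrable_density) auto
    finally show "integrable M (\<lambda>\<omega>. h (Y \<omega>) * g (Y \<omega>)) \<longleftrightarrow>
        integrable uniform01 (\<lambda>p. \<sigma> p * g (value_at_risk M Y p))" unfolding G_def .
    have "(LINT \<omega>|M. h (Y \<omega>) * g (Y \<omega>)) = (LINT y|\<mu>. h y * g y)"
      unfolding \<mu>_def using Y by (subst integral_distr) auto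
    also have "\<dots> = (LINT y|\<nu>. g y)"
      unfolding \<nu> using h_nonneg by (subst integral_density) auto
    also have "\<dots> = (LINT p|density uniform01 \<sigma>. g (G p))"
      unfolding \<nu>_def by (subst integral_distr) auto
    also have "\<dots> = (LINT p|uniform01. \<sigma> p * g (G p))"
      using \<sigma>_nonneg by (subst integral_density) auto
    finally show "(LINT \<omega>|M. h (Y \<omega>) * g (Y \<omega>)) =
        (LINT p|uniform01. \<sigma> p * g (value_at_risk M Y p))" unfolding G_def .
  qed
qed

text \<open>The excess of \<open>h (Y)\<close> over \<open>q\<close> is bounded as in Jensen's inequality: on the event \<open>q < h (Y)\<close>,
  which depends on \<open>Y\<close> only, \<open>h\<close> may be replaced by \<open>\<sigma>\<close>.\<close>

lemma spectral_risk_attained: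
  assumes \<sigma>: "spectral_density \<sigma>" and Y: "Y \<in> borel_measurable M"
  obtains Z where "spectrally_dominated M \<sigma> Z" "(LINT \<omega>|M. Y \<omega> * Z \<omega>) = spectral_risk M \<sigma> Y"
proof -
  note [measurable] = Y
  obtain h :: "real \<Rightarrow> real" where h[measurable]: "h \<in> borel_measurable borel"
    and hi: "\<And>g. g \<in> borel_measurable borel \<Longrightarrow> integrable M (\<lambda>\<omega>. h (Y \<omega>) * g (Y \<omega>)) \<longleftrightarrow>
        integrable uniform01 (\<lambda>p. \<sigma> p * g (value_at_risk M Y p))"
    and he: "\<And>g. g \<in> borel_measurable borel \<Longrightarrow>
      (LINT \<omega>|M. h (Y \<omega>) * g (Y \<omega>)) = (LINT p|uniform01. \<sigma> p * g (value_at_risk M Y p))"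
    by (rule spectrum_conditional_expectation[OF assms]) blast
  have Gm: "value_at_risk M Y \<in> borel_measurable uniform01"
    by (rule measurable_value_at_risk[OF Y])
  have int: "integrable M (\<lambda>\<omega>. h (Y \<omega>))" "(LINT \<omega>|M. h (Y \<omega>)) = 1"
    using hi[of "\<lambda>_. 1"] he[of "\<lambda>_. 1"] spectral_densityD(3,4)[OF \<sigma>] by auto
  have "spectrally_dominated M \<sigma> (\<lambda>\<omega>. h (Y \<omega>))"
  proof (rule spectrally_dominatedI[OF \<sigma> int])
    fix q :: real
    define g where "g = (\<lambda>y. indicator {y. q < h y} y :: real)"
    have gm[measurable]: "g \<in> borel_measurable borel" unfolding g_def by measurable
    have gG[measurable]: "(\<lambda>p. g (value_at_risk M Y p)) \<in> borel_measurable uniform01"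
      using Gm gm by (rule measurable_compose)
    interpret U: prob_space uniform01 by (rule prob_space_uniform01)
    have g_bound: "\<bar>g y\<bar> \<le> 1" for y by (simp add: g_def indicator_def)
    have i1: "integrable uniform01 (\<lambda>p. g (value_at_risk M Y p))"
      by (rule U.integrable_const_bound[where B = 1]) (use g_bound gG in auto)
    have i2: "integrable uniform01 (\<lambda>p. \<sigma> p * g (value_at_risk M Y p))"
      using integrable_AE_bounded_mult[OF gG _ spectral_densityD(3)[OF \<sigma>], of 1] g_bound
      by (simp add: mult.commute)
    have "(LINT \<omega>|M. max (h (Y \<omega>) - q) 0) = (LINT \<omega>|M. h (Y \<omega>) * g (Y \<omega>) - q * g (Y \<omega>))"
      by (intro Bochner_Integration.integral_cong) (auto simp: g_def indicator_def max_def)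
    also have "\<dots> = (LINT \<omega>|M. h (Y \<omega>) * g (Y \<omega>)) - q * (LINT \<omega>|M. g (Y \<omega>))"
      using hi[OF gm] i2 integrable_value_at_risk[OF Y gm] i1 by simp
    also have "\<dots> = (LINT p|uniform01. \<sigma> p * g (value_at_risk M Y p)) - q * (LINT p|uniform01. g (value_at_risk M Y p))"
      using he[OF gm] integral_value_at_risk[OF Y gm] by simp
    also have "\<dots> = (LINT p|uniform01. \<sigma> p * g (value_at_risk M Y p) - q * g (value_at_risk M Y p))"
      using i1 i2 by simp
    also have "\<dots> \<le> (LINT p|uniform01. max (\<sigma> p - q) 0)"
      using i1 i2 integrable_excess[OF prob_space_uniform01 spectral_densityD(3)[OF \<sigma>]]
      by (intro integral_mono) (auto simp: g_def indicator_def)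
    finally show "(LINT \<omega>|M. max (h (Y \<omega>) - q) 0) \<le> (LINT p|uniform01. max (\<sigma> p - q) 0)" .
  qed
  moreover have "(LINT \<omega>|M. Y \<omega> * h (Y \<omega>)) = spectral_risk M \<sigma> Y"
    using he[of "\<lambda>y. y"] by (simp add: spectral_risk_def integral_uniform01_0 mult.commute)
  ultimately show ?thesis by (rule that)
qed

end

section \<open>Spectra evaluated at uniform variables\<close>

context prob_space
begin

lemma value_at_risk_uniformly_distributed:
  assumes U: "uniformly_distributed M U" and p: "0 < p" "p < 1"
  shows "value_at_risk M U p = p"
proof -
  have Um: "U \<in> borel_measurable M" and cdf: "\<And>u. 0 \<le> u \<Longrightarrow> u \<le> 1 \<Longrightarrow> prob {\<omega> \<in> space M. U \<omega> \<le> u} = u"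
    using U by (auto simp: uniformly_distributed_def)
  note iff = value_at_risk_le_iff[OF Um p]
  have "value_at_risk M U p \<le> p" using iff cdf[of p] p by simp
  moreover have "\<not> value_at_risk M U p < p"
  proof
    assume less: "value_at_risk M U p < p"
    define y where "y = max (value_at_risk M U p) 0"
    have "p \<le> prob {\<omega> \<in> space M. U \<omega> \<le> y}" unfolding iff[symmetric] y_def by simp
    then show False using cdf[of y] less p by (auto simp: y_def)
  qed
  ultimately show ?thesis by simp
qed

lemma distr_uniformly_distributed:
  assumes U: "uniformly_distributed M U"
  shows "distr M borel U = distr uniform01 borel (\<lambda>p. p)"
proof -
  have Um: "U \<in> borel_measurable M" using U by (simp add: uniformly_distributed_def)
  have "distr M borel U = distr uniform01 borel (value_at_risk M U)"
    by (rule distr_value_at_risk[OF Um, symmetric])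
  also have "\<dots> = distr uniform01 borel (\<lambda>p. p)"
    by (rule distr_cong) (auto simp: value_at_risk_uniformly_distributed[OF U])
  finally show ?thesis .
qed

lemma measurable_ident_uniform01: "(\<lambda>p. p) \<in> borel_measurable uniform01"
  by (intro measurable_restrict_space1) simp

lemma integral_uniformly_distributed:
  fixes g :: "real \<Rightarrow> real"
  assumes U: "uniformly_distributed M U" and g: "g \<in> borel_measurable borel"
  shows "(LINT \<omega>|M. g (U \<omega>)) = (LINT p|uniform01. g p)"
    and "integrable M (\<lambda>\<omega>. g (U \<omega>)) \<longleftrightarrow> integrable uniform01 g"
proof -
  have Um: "U \<in> borel_measurable M" using U by (simp add: uniformly_distributed_def)
  show "(LINT \<omega>|M. g (U \<omega>)) = (LINT p|uniform01. g p)"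
    using integral_distr[OF Um g] integral_distr[OF measurable_ident_uniform01 g]
      distr_uniformly_distributed[OF U] by simp
  show "integrable M (\<lambda>\<omega>. g (U \<omega>)) \<longleftrightarrow> integrable uniform01 g"
    using integrable_distr_eq[OF Um g] integrable_distr_eq[OF measurable_ident_uniform01 g]
      distr_uniformly_distributed[OF U] by simp
qed

lemma AE_uniformly_distributed:
  assumes U: "uniformly_distributed M U" and P: "{x. P x} \<in> sets borel" "\<And>p. 0 < p \<Longrightarrow> p < 1 \<Longrightarrow> P p"
  shows "AE \<omega> in M. P (U \<omega>)"
proof -
  have Um: "U \<in> borel_measurable M" using U by (simp add: uniformly_distributed_def)
  show ?thesis
    unfolding AE_value_at_risk[OF Um P(1), symmetric]
    by (rule AE_I2) (use P(2) value_at_risk_uniformly_distributed[OF U] in auto)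
qed

end

text \<open>The spectrum set to zero outside \<open>(0,1)\<close>, which makes it Borel measurable on the whole line and
  lets it be composed with a uniform variable that leaves \<open>(0,1)\<close> on a null set.\<close>

definition truncated_spectrum :: "(real \<Rightarrow> real) \<Rightarrow> real \<Rightarrow> real" where
  "truncated_spectrum \<sigma> u = indicator {0<..<1} u * \<sigma> u"

lemma truncated_spectrum_measurable:
  assumes "spectral_density \<sigma>"
  shows "truncated_spectrum \<sigma> \<in> borel_measurable borel"
proof -
  have "integrable lborel (truncated_spectrum \<sigma>)"
    using assms by (simp add: spectral_density_def set_integrable_def truncated_spectrum_def[abs_def])
  then show ?thesis by auto
qed

lemma set_integral_spectrum_eq:
  "(LINT \<omega>:{\<omega> \<in> space M. 0 < U \<omega> \<and> U \<omega> < 1}|M. Y \<omega> * \<sigma> (U \<omega>))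
    = (LINT \<omega>|M. Y \<omega> * truncated_spectrum \<sigma> (U \<omega>))"
  unfolding set_lebesgue_integral_def truncated_spectrum_def
  by (intro Bochner_Integration.integral_cong) (auto simp: indicator_def)

context prob_space
begin

text \<open>The pair \<open>(U, \<sigma> (U))\<close> has the law of \<open>(p, \<sigma> p)\<close> for \<open>p\<close> uniform on \<open>(0,1)\<close>.\<close>

lemma integral_spectrum_uniform:
  fixes g :: "real \<Rightarrow> real \<Rightarrow> real"
  assumes \<sigma>: "spectral_density \<sigma>" and U: "uniformly_distributed M U"
    and g: "(\<lambda>(x, y). g x y) \<in> borel_measurable (borel \<Otimes>\<^sub>M borel)"
  shows "(LINT \<omega>|M. g (U \<omega>) (truncated_spectrum \<sigma> (U \<omega>))) = (LINT p|uniform01. g p (\<sigma> p))"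
    and "integrable M (\<lambda>\<omega>. g (U \<omega>) (truncated_spectrum \<sigma> (U \<omega>))) \<longleftrightarrow> integrable uniform01 (\<lambda>p. g p (\<sigma> p))"
proof -
  note [measurable] = truncated_spectrum_measurable[OF \<sigma>]
  have "(\<lambda>u. (\<lambda>(x, y). g x y) (u, truncated_spectrum \<sigma> u)) \<in> borel_measurable borel"
    by (rule measurable_compose[OF _ g]) measurable
  then have m: "(\<lambda>u. g u (truncated_spectrum \<sigma> u)) \<in> borel_measurable borel" by simp
  have eq: "g p (truncated_spectrum \<sigma> p) = g p (\<sigma> p)" if "p \<in> space uniform01" for p
    using that by (simp add: truncated_spectrum_def)
  show "(LINT \<omega>|M. g (U \<omega>) (truncated_spectrum \<sigma> (U \<omega>))) = (LINT p|uniform01. g p (\<sigma> p))"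
    unfolding integral_uniformly_distributed(1)[OF U m]
    by (rule Bochner_Integration.integral_cong[OF refl eq])
  show "integrable M (\<lambda>\<omega>. g (U \<omega>) (truncated_spectrum \<sigma> (U \<omega>))) \<longleftrightarrow> integrable uniform01 (\<lambda>p. g p (\<sigma> p))"
    unfolding integral_uniformly_distributed(2)[OF U m]
    by (rule Bochner_Integration.integrable_cong[OF refl eq])
qed

lemma spectrally_dominated_spectrum_uniform:
  assumes \<sigma>: "spectral_density \<sigma>" and U: "uniformly_distributed M U"
  shows "spectrally_dominated M \<sigma> (\<lambda>\<omega>. truncated_spectrum \<sigma> (U \<omega>))"
proof (rule spectrally_dominatedI[OF \<sigma>])
  note I = integral_spectrum_uniform[OF \<sigma> U]
  show "integrable M (\<lambda>\<omega>. truncated_spectrum \<sigma> (U \<omega>))"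
    using I(2)[of "\<lambda>x y. y"] spectral_densityD(3)[OF \<sigma>] by simp
  show "(LINT \<omega>|M. truncated_spectrum \<sigma> (U \<omega>)) = 1"
    using I(1)[of "\<lambda>x y. y"] spectral_densityD(4)[OF \<sigma>] by simp
  show "(LINT \<omega>|M. max (truncated_spectrum \<sigma> (U \<omega>) - q) 0) \<le> (LINT p|uniform01. max (\<sigma> p - q) 0)" for q
    using I(1)[of "\<lambda>x y. max (y - q) 0"] by simp
qed

section \<open>Comonotone coupling\<close>

lemma AE_eq_of_AE_subset:
  assumes "A \<in> events" "B \<in> events" "prob A = prob B" "AE \<omega> in M. \<omega> \<in> A \<longrightarrow> \<omega> \<in> B"
  shows "AE \<omega> in M. \<omega> \<in> A \<longleftrightarrow> \<omega> \<in> B"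
proof -
  have "prob (A \<inter> B) = prob A"
    using assms by (intro measure_eq_AE) auto
  then have "prob (B - A) = 0"
    using assms finite_measure_Diff'[of B A] by (simp add: Int_commute)
  then have "AE \<omega> in M. \<omega> \<notin> B - A"
    using assms by (subst (asm) prob_eq_0) auto
  with assms(4) show ?thesis by eventually_elim auto
qed

text \<open>Upper level sets of comonotone variables are nested up to a null set, so equally likely ones
  coincide.\<close>

lemma comonotone_AE_eq:
  assumes U: "uniformly_distributed M U" and Y[measurable]: "Y \<in> borel_measurable M"
    and com: "comonotone M Y U"
  shows "AE \<omega> in M. t < Y \<omega> \<longleftrightarrow> 1 - prob {\<omega> \<in> space M. t < Y \<omega>} < U \<omega>"
proof -
  have Um[measurable]: "U \<in> borel_measurable M" using U by (simp add: uniformly_distributed_def)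
  obtain \<Omega> where \<Omega>: "\<Omega> \<in> events" "prob \<Omega> = 1"
    and c: "\<And>\<omega> \<omega>'. \<omega> \<in> \<Omega> \<Longrightarrow> \<omega>' \<in> \<Omega> \<Longrightarrow> 0 \<le> (Y \<omega> - Y \<omega>') * (U \<omega> - U \<omega>')"
    using com by (auto simp: comonotone_def)
  have ae: "AE \<omega> in M. \<omega> \<in> \<Omega>" using \<Omega> by (simp add: prob_eq_1)
  define A where "A = {\<omega> \<in> space M. t < Y \<omega>}"
  define B where "B = {\<omega> \<in> space M. 1 - prob A < U \<omega>}"
  have AB: "A \<in> events" "B \<in> events" unfolding A_def B_def by measurable
  have "1 - prob B = 1 - prob A"
    using U prob_le_eq_compl_greater[OF Um, of "1 - prob A"] prob_le_1[of A] measure_nonneg[of M A]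
    by (simp add: uniformly_distributed_def B_def)
  then have p: "prob A = prob B" by simp
  have "A \<inter> \<Omega> \<subseteq> B \<or> B \<inter> \<Omega> \<subseteq> A"
  proof (rule ccontr)
    assume "\<not> ?thesis"
    then obtain \<omega> \<omega>' where "\<omega> \<in> A - B" "\<omega> \<in> \<Omega>" "\<omega>' \<in> B - A" "\<omega>' \<in> \<Omega>" by auto
    moreover from this have "0 < (Y \<omega> - Y \<omega>') * (U \<omega>' - U \<omega>)"
      by (intro mult_pos_pos) (auto simp: A_def B_def)
    ultimately show False using c[of \<omega> \<omega>'] by (simp add: algebra_simps)
  qed
  then have "AE \<omega> in M. \<omega> \<in> A \<longleftrightarrow> \<omega> \<in> B"
  proof
    assume "A \<inter> \<Omega> \<subseteq> B"
    then show ?thesis using ae by (intro AE_eq_of_AE_subset AB p) auto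
  next
    assume "B \<inter> \<Omega> \<subseteq> A"
    then have "AE \<omega> in M. \<omega> \<in> B \<longleftrightarrow> \<omega> \<in> A"
      using ae by (intro AE_eq_of_AE_subset AB p[symmetric]) auto
    then show ?thesis by eventually_elim auto
  qed
  with AE_space show ?thesis
    by eventually_elim (auto simp: A_def B_def)
qed

lemma integral_comonotone_eq_spectral_risk:
  assumes \<sigma>: "spectral_density \<sigma>" and Y: "essentially_bounded M Y"
    and U: "uniformly_distributed M U" and com: "comonotone M Y U"
  shows "(LINT \<omega>|M. Y \<omega> * truncated_spectrum \<sigma> (U \<omega>)) = spectral_risk M \<sigma> Y"
proof (rule integral_eq_spectral_riskI[OF \<sigma> Y])
  have Ym[measurable]: "Y \<in> borel_measurable M" using Y by (simp add: essentially_bounded_def)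
  have Um[measurable]: "U \<in> borel_measurable M" using U by (simp add: uniformly_distributed_def)
  note [measurable] = truncated_spectrum_measurable[OF \<sigma>]
  have D: "spectrally_dominated M \<sigma> (\<lambda>\<omega>. truncated_spectrum \<sigma> (U \<omega>))"
    by (rule spectrally_dominated_spectrum_uniform[OF \<sigma> U])
  then show "integrable M (\<lambda>\<omega>. truncated_spectrum \<sigma> (U \<omega>))" "(LINT \<omega>|M. truncated_spectrum \<sigma> (U \<omega>)) = 1"
    by (simp_all add: spectrally_dominated_def)
  fix t
  define u where "u = 1 - prob {\<omega> \<in> space M. t < Y \<omega>}"
  have "(LINT \<omega>|M. indicator {\<omega> \<in> space M. t < Y \<omega>} \<omega> * truncated_spectrum \<sigma> (U \<omega>)) =
      (LINT \<omega>|M. indicator {u<..} (U \<omega>) * truncated_spectrum \<sigma> (U \<omega>))"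
  proof (rule integral_cong_AE)
    show "AE \<omega> in M. indicator {\<omega> \<in> space M. t < Y \<omega>} \<omega> * truncated_spectrum \<sigma> (U \<omega>) =
        indicator {u<..} (U \<omega>) * truncated_spectrum \<sigma> (U \<omega>)"
      using comonotone_AE_eq[OF U Ym com, of t, folded u_def] AE_space
      by eventually_elim (auto simp: indicator_def)
  qed measurable
  also have "\<dots> = (LINT p|uniform01. indicator {u<..} p * \<sigma> p)"
    by (rule integral_spectrum_uniform(1)[OF \<sigma> U, of "\<lambda>x y. indicator {u<..} x * y"]) measurable
  finally show "(LINT \<omega>|M. indicator {\<omega> \<in> space M. t < Y \<omega>} \<omega> * truncated_spectrum \<sigma> (U \<omega>)) =
      (LINT p|uniform01. indicator {1 - prob {\<omega> \<in> space M. t < Y \<omega>}<..} p * \<sigma> p)"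
    unfolding u_def .
qed

section \<open>Approximation of the risk by uniform variables\<close>

text \<open>Since the distribution function \<open>F\<close> of \<open>W\<close> is continuous, it inverts the quantile function exactly,
  and the quantile transform carries \<open>F (W)\<close> to the identity on \<open>(0,1)\<close>.\<close>

lemma uniformly_distributed_cdf_transform:
  fixes W :: "'a \<Rightarrow> real"
  assumes W[measurable]: "W \<in> borel_measurable M" and atomless: "\<And>c. prob {\<omega> \<in> space M. W \<omega> = c} = 0"
  shows "uniformly_distributed M (\<lambda>\<omega>. cdf (distr M borel W) (W \<omega>))"
proof -
  interpret D: cdf_distribution "distr M borel W"
    by (rule cdf_distribution_distr[OF W])
  define F where "F = cdf (distr M borel W)"
  have Fm[measurable]: "F \<in> borel_measurable borel"
    unfolding F_def by (rule D.measurable_C)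
  have F_quantile: "F (value_at_risk M W p) = p" if p: "0 < p" "p < 1" for p
  proof (rule antisym)
    have le_iff: "value_at_risk M W p \<le> y \<longleftrightarrow> p \<le> F y" for y
      using value_at_risk_le_iff[OF W p] cdf_distr_eq[OF W] by (simp add: F_def)
    then show "p \<le> F (value_at_risk M W p)" by blast
    have "measure (distr M borel W) {x} = 0" for x
      using atomless[of x] by (simp add: measure_distr vimage_def Int_def conj_commute)
    then have "isCont F (value_at_risk M W p)"
      unfolding F_def by (simp add: D.isCont_cdf)
    then have "(F \<longlongrightarrow> F (value_at_risk M W p)) (at_left (value_at_risk M W p))"
      by (simp add: isCont_def filterlim_at_split)
    moreover have "F y \<le> p" if "y < value_at_risk M W p" for y
      using le_iff[of y] that by linarith
    then have "eventually (\<lambda>y. F y \<le> p) (at_left (value_at_risk M W p))"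
      unfolding eventually_at_filter by (intro always_eventually) simp
    ultimately show "F (value_at_risk M W p) \<le> p"
      by (rule tendsto_upperbound) simp
  qed
  have "prob {\<omega> \<in> space M. F (W \<omega>) \<le> u} = u" if u: "0 \<le> u" "u \<le> 1" for u
  proof -
    have "prob {\<omega> \<in> space M. F (W \<omega>) \<le> u} = (LINT \<omega>|M. indicator {x. F x \<le> u} (W \<omega>))"
    proof -
      have "{\<omega> \<in> space M. F (W \<omega>) \<le> u} \<in> events" by measurable
      then have "prob {\<omega> \<in> space M. F (W \<omega>) \<le> u} = (LINT \<omega>|M. indicator {\<omega> \<in> space M. F (W \<omega>) \<le> u} \<omega>)"
        by simp
      also have "\<dots> = (LINT \<omega>|M. indicator {x. F x \<le> u} (W \<omega>))"
        by (intro Bochner_Integration.integral_cong) (auto simp: indicator_def)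
      finally show ?thesis .
    qed
    also have "\<dots> = (LINT p|uniform01. indicator {x. F x \<le> u} (value_at_risk M W p))"
      by (rule integral_value_at_risk[OF W, symmetric]) measurable
    also have "\<dots> = (LINT p|uniform01. 1 - indicator {u<..} p)"
      by (intro Bochner_Integration.integral_cong) (auto simp: indicator_def F_quantile)
    also have "\<dots> = u"
    proof -
      interpret U: prob_space uniform01 by (rule prob_space_uniform01)
      have "integrable uniform01 (indicator {u<..} :: real \<Rightarrow> real)"
        by (rule U.integrable_const_bound[where B = 1]) auto
      then show ?thesis using measure_uniform01_greaterThan[OF u] U.prob_space by simp
    qed
    finally show ?thesis .
  qed
  then show ?thesis
    unfolding uniformly_distributed_def F_def by auto
qed

text \<open>The witness rounds \<open>Y\<close> down to the grid of mesh \<open>e\<close>, shifts it up by one step and adds \<open>e V\<close>. An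
  event \<open>W = c\<close> forces \<open>V\<close> into a countable set, so it is null whatever the joint law of \<open>Y\<close> and \<open>V\<close>.\<close>

lemma atomless_upper_approximation:
  fixes Y :: "'a \<Rightarrow> real"
  assumes Y[measurable]: "Y \<in> borel_measurable M" and V: "uniformly_distributed M V" and e: "0 < e"
  obtains W :: "'a \<Rightarrow> real" where "W \<in> borel_measurable M"
    "\<And>c. prob {\<omega> \<in> space M. W \<omega> = c} = 0"
    "AE \<omega> in M. Y \<omega> \<le> W \<omega> \<and> W \<omega> \<le> Y \<omega> + 2 * e"
proof
  have Vm[measurable]: "V \<in> borel_measurable M" using V by (simp add: uniformly_distributed_def)
  define W where "W = (\<lambda>\<omega>. e * (real_of_int \<lfloor>Y \<omega> / e\<rfloor> + 1 + V \<omega>))"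
  show Wm[measurable]: "W \<in> borel_measurable M"
    unfolding W_def by measurable
  have V_atom: "prob {\<omega> \<in> space M. V \<omega> = c} = 0" for c
  proof -
    have "(\<lambda>x. indicator {c} x :: real) \<in> borel_measurable borel" by measurable
    from integral_uniformly_distributed(1)[OF V this]
    have "(LINT \<omega>|M. indicator {c} (V \<omega>)) = (LINT p|uniform01. indicator {c} p :: real)" .
    also have "\<dots> = (LINT p|lborel. indicator {0<..<1} p * indicator {c} p)"
      by (subst integral_restrict_space) auto
    also have "\<dots> = 0"
      by (rule integral_eq_zero_AE) (use AE_lborel_singleton[of c] in eventually_elim, simp)
    also have "(LINT \<omega>|M. indicator {c} (V \<omega>)) = (LINT \<omega>|M. indicator {\<omega> \<in> space M. V \<omega> = c} \<omega> :: real)"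
      by (intro Bochner_Integration.integral_cong) (auto simp: indicator_def)
    finally show ?thesis by simp
  qed
  show "prob {\<omega> \<in> space M. W \<omega> = c} = 0" for c
  proof -
    have "AE \<omega> in M. V \<omega> \<noteq> c / e - 1 - real_of_int k" for k
      using V_atom[of "c / e - 1 - real_of_int k"]
      by (subst (asm) prob_eq_0) auto
    then have "AE \<omega> in M. \<forall>k. V \<omega> \<noteq> c / e - 1 - real_of_int k"
      by (subst AE_all_countable) auto
    then have "AE \<omega> in M. W \<omega> \<noteq> c"
    proof eventually_elim
      fix \<omega> assume *: "\<forall>k. V \<omega> \<noteq> c / e - 1 - real_of_int k"
      show "W \<omega> \<noteq> c"
      proof
        assume "W \<omega> = c"
        then have "V \<omega> = c / e - 1 - real_of_int \<lfloor>Y \<omega> / e\<rfloor>"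
          using e by (auto simp: W_def)
        with * show False by blast
      qed
    qed
    then show ?thesis by (subst prob_eq_0) auto
  qed
  have "{x::real. 0 \<le> x \<and> x \<le> 1} \<in> sets borel" by measurable
  from AE_uniformly_distributed[OF V this] have "AE \<omega> in M. 0 \<le> V \<omega> \<and> V \<omega> \<le> 1" by simp
  then show "AE \<omega> in M. Y \<omega> \<le> W \<omega> \<and> W \<omega> \<le> Y \<omega> + 2 * e"
  proof eventually_elim
    fix \<omega> assume V01: "0 \<le> V \<omega> \<and> V \<omega> \<le> 1"
    have "real_of_int \<lfloor>Y \<omega> / e\<rfloor> \<le> Y \<omega> / e" "Y \<omega> / e \<le> real_of_int \<lfloor>Y \<omega> / e\<rfloor> + 1"
      by linarith+
    with V01 have "Y \<omega> / e \<le> real_of_int \<lfloor>Y \<omega> / e\<rfloor> + 1 + V \<omega>"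
      "real_of_int \<lfloor>Y \<omega> / e\<rfloor> + 1 + V \<omega> \<le> Y \<omega> / e + 2"
      by linarith+
    then have "e * (Y \<omega> / e) \<le> W \<omega>" "W \<omega> \<le> e * (Y \<omega> / e + 2)"
      unfolding W_def using e by (intro mult_left_mono, simp, simp)+
    then show "Y \<omega> \<le> W \<omega> \<and> W \<omega> \<le> Y \<omega> + 2 * e"
      using e by (simp add: distrib_left)
  qed
qed

lemma integrable_value_at_risk_spectrum:
  assumes \<sigma>: "spectral_density \<sigma>" and Y: "essentially_bounded M Y"
  shows "integrable uniform01 (\<lambda>p. value_at_risk M Y p * \<sigma> p)"
proof -
  obtain C where Y: "Y \<in> borel_measurable M" "AE \<omega> in M. \<bar>Y \<omega>\<bar> \<le> C"
    using Y by (auto simp: essentially_bounded_def)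
  show ?thesis
    by (rule integrable_AE_bounded_mult[OF measurable_value_at_risk[OF Y(1)]
        AE_bounded_value_at_risk[OF Y] spectral_densityD(3)[OF \<sigma>]])
qed

lemma spectral_risk_mono:
  assumes \<sigma>: "spectral_density \<sigma>" and Y: "essentially_bounded M Y" and W: "essentially_bounded M W"
    and le: "AE \<omega> in M. Y \<omega> \<le> W \<omega>"
  shows "spectral_risk M \<sigma> Y \<le> spectral_risk M \<sigma> W"
proof -
  have [measurable]: "Y \<in> borel_measurable M" "W \<in> borel_measurable M"
    using Y W by (auto simp: essentially_bounded_def)
  have "value_at_risk M Y p \<le> value_at_risk M W p" if p: "0 < p" "p < 1" for p
  proof -
    define y where "y = value_at_risk M W p"
    have "p \<le> prob {\<omega> \<in> space M. W \<omega> \<le> y}"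
      using value_at_risk_le_iff[of W p y] p by (simp add: y_def)
    also have "\<dots> \<le> prob {\<omega> \<in> space M. Y \<omega> \<le> y}"
      using le by (intro finite_measure_mono_AE) auto
    finally show ?thesis
      using value_at_risk_le_iff[of Y p y] p by (simp add: y_def)
  qed
  then show ?thesis
    unfolding spectral_risk_def integral_uniform01_0
    by (intro integral_mono integrable_value_at_risk_spectrum[OF \<sigma>] Y W)
       (auto intro!: mult_right_mono spectral_densityD(2)[OF \<sigma>])
qed

text \<open>Take \<open>U = F\<^sub>W (W)\<close> for an atomless \<open>W\<close> between \<open>Y\<close> and \<open>Y + 2 e\<close>. Since \<open>\<sigma> (U)\<close> is nonnegative of
  mean one, replacing \<open>W\<close> by \<open>Y\<close> costs at most \<open>2 e\<close>.\<close>

lemma ex_uniform_near_spectral_risk: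
  assumes \<sigma>: "spectral_density \<sigma>" and Y: "essentially_bounded M Y"
    and V: "uniformly_distributed M V" and e: "0 < e"
  obtains U where "uniformly_distributed M U"
    "spectral_risk M \<sigma> Y \<le> (LINT \<omega>|M. Y \<omega> * truncated_spectrum \<sigma> (U \<omega>)) + 2 * e"
proof -
  obtain C where Ym[measurable]: "Y \<in> borel_measurable M" and C: "AE \<omega> in M. \<bar>Y \<omega>\<bar> \<le> C"
    using Y by (auto simp: essentially_bounded_def)
  obtain W :: "'a \<Rightarrow> real" where W[measurable]: "W \<in> borel_measurable M"
    and atomless: "\<And>c. prob {\<omega> \<in> space M. W \<omega> = c} = 0"
    and near: "AE \<omega> in M. Y \<omega> \<le> W \<omega> \<and> W \<omega> \<le> Y \<omega> + 2 * e"
    by (rule atomless_upper_approximation[OF Ym V e]) blast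
  have "AE \<omega> in M. \<bar>W \<omega>\<bar> \<le> C + 2 * e"
    using C near by eventually_elim (use e in auto)
  then have WC: "AE \<omega> in M. \<bar>W \<omega>\<bar> \<le> C + 2 * e" "essentially_bounded M W"
    using W unfolding essentially_bounded_def by auto
  interpret D: cdf_distribution "distr M borel W"
    by (rule cdf_distribution_distr[OF W])
  define U where "U = (\<lambda>\<omega>. cdf (distr M borel W) (W \<omega>))"
  have U: "uniformly_distributed M U"
    unfolding U_def by (rule uniformly_distributed_cdf_transform[OF W atomless])
  have "0 \<le> (W \<omega> - W \<omega>') * (U \<omega> - U \<omega>')" for \<omega> \<omega>'
    using D.cdf_nondecreasing[of "W \<omega>" "W \<omega>'"] D.cdf_nondecreasing[of "W \<omega>'" "W \<omega>"]
    by (cases "W \<omega> \<le> W \<omega>'") (auto simp: U_def intro: mult_nonneg_nonneg mult_nonpos_nonpos)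
  then have "comonotone M W U"
    unfolding comonotone_def using prob_space by (intro bexI[of _ "space M"]) auto
  note R = integral_comonotone_eq_spectral_risk[OF \<sigma> WC(2) U this]
  have Z: "integrable M (\<lambda>\<omega>. truncated_spectrum \<sigma> (U \<omega>))" "(LINT \<omega>|M. truncated_spectrum \<sigma> (U \<omega>)) = 1"
    using spectrally_dominated_spectrum_uniform[OF \<sigma> U] by (simp_all add: spectrally_dominated_def)
  have Z_nonneg: "0 \<le> truncated_spectrum \<sigma> u" for u
    using spectral_densityD(2)[OF \<sigma>] by (simp add: truncated_spectrum_def indicator_def)
  note YZ = integrable_AE_bounded_mult[OF Ym C Z(1)]
  have "spectral_risk M \<sigma> Y \<le> spectral_risk M \<sigma> W"
    by (rule spectral_risk_mono[OF \<sigma> Y WC(2)]) (use near in eventually_elim, simp)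
  also have "\<dots> = (LINT \<omega>|M. W \<omega> * truncated_spectrum \<sigma> (U \<omega>))"
    by (rule R[symmetric])
  also have "\<dots> \<le> (LINT \<omega>|M. Y \<omega> * truncated_spectrum \<sigma> (U \<omega>) + 2 * e * truncated_spectrum \<sigma> (U \<omega>))"
  proof (rule integral_mono_AE)
    show "integrable M (\<lambda>\<omega>. W \<omega> * truncated_spectrum \<sigma> (U \<omega>))"
      by (rule integrable_AE_bounded_mult[OF W WC(1) Z(1)])
    show "integrable M (\<lambda>\<omega>. Y \<omega> * truncated_spectrum \<sigma> (U \<omega>) + 2 * e * truncated_spectrum \<sigma> (U \<omega>))"
      using YZ Z(1) by simp
    show "AE \<omega> in M. W \<omega> * truncated_spectrum \<sigma> (U \<omega>)
        \<le> Y \<omega> * truncated_spectrum \<sigma> (U \<omega>) + 2 * e * truncated_spectrum \<sigma> (U \<omega>)"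
      using near
      by eventually_elim (use Z_nonneg in \<open>auto simp flip: distrib_right intro!: mult_right_mono\<close>)
  qed
  also have "\<dots> = (LINT \<omega>|M. Y \<omega> * truncated_spectrum \<sigma> (U \<omega>)) + 2 * e"
    using YZ Z by simp
  finally show ?thesis by (rule that[OF U])
qed

end

theorem theorem10:
  fixes M :: "'a measure" and \<sigma> :: "real \<Rightarrow> real" and Y :: "'a \<Rightarrow> real"
  assumes "prob_space M"
    and "spectral_density \<sigma>"
    and "essentially_bounded M Y"
  shows "(ereal (spectral_risk M \<sigma> Y) =
            (SUP Z \<in> {Z. integrable M Z \<and> dominated_by_spectrum M Z \<sigma>}.
               ereal (LINT \<omega>|M. Y \<omega> * Z \<omega>)) \<and>
          ereal (spectral_risk M \<sigma> Y) =
            (SUP Z \<in> {Z. integrable M Z \<and> (LINT \<omega>|M. Z \<omega>) = 1 \<and>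
                 (\<forall>\<alpha>\<in>{0..<1}. ereal (1 - \<alpha>) * average_value_at_risk M Z \<alpha>
                    \<le> ereal (LBINT p:{\<alpha><..<1}. \<sigma> p))}.
               ereal (LINT \<omega>|M. Y \<omega> * Z \<omega>))) \<and>
         ((\<exists>U. uniformly_distributed M U) \<longrightarrow>
          ereal (spectral_risk M \<sigma> Y) =
            (SUP U \<in> {U. uniformly_distributed M U}.
               ereal (LINT \<omega>:{\<omega> \<in> space M. 0 < U \<omega> \<and> U \<omega> < 1}|M. Y \<omega> * \<sigma> (U \<omega>))) \<and>
          (\<forall>U. uniformly_distributed M U \<and> comonotone M Y U \<longrightarrow>
             (LINT \<omega>:{\<omega> \<in> space M. 0 < U \<omega> \<and> U \<omega> < 1}|M. Y \<omega> * \<sigma> (U \<omega>))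
               = spectral_risk M \<sigma> Y))"
proof -
  interpret prob_space M by fact
  note \<sigma> = assms(2) and Y = assms(3)
  have Ym: "Y \<in> borel_measurable M" using Y by (simp add: essentially_bounded_def)
  let ?R = "ereal (spectral_risk M \<sigma> Y)"
  have dual: "?R = (SUP Z \<in> {Z. spectrally_dominated M \<sigma> Z}. ereal (LINT \<omega>|M. Y \<omega> * Z \<omega>))"
  proof (rule antisym)
    obtain Z where "spectrally_dominated M \<sigma> Z" "(LINT \<omega>|M. Y \<omega> * Z \<omega>) = spectral_risk M \<sigma> Y"
      by (rule spectral_risk_attained[OF \<sigma> Ym])
    then show "?R \<le> (SUP Z \<in> {Z. spectrally_dominated M \<sigma> Z}. ereal (LINT \<omega>|M. Y \<omega> * Z \<omega>))"
      by (intro SUP_upper2[of Z]) auto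
    show "(SUP Z \<in> {Z. spectrally_dominated M \<sigma> Z}. ereal (LINT \<omega>|M. Y \<omega> * Z \<omega>)) \<le> ?R"
      using integral_le_spectral_risk[OF \<sigma> Y] by (intro SUP_least) auto
  qed
  have uniform: "?R = (SUP U \<in> {U. uniformly_distributed M U}.
      ereal (LINT \<omega>|M. Y \<omega> * truncated_spectrum \<sigma> (U \<omega>)))" (is "_ = ?S")
    if ex: "\<exists>U. uniformly_distributed M U"
  proof (rule antisym)
    obtain V where V: "uniformly_distributed M V" using ex by blast
    show "?R \<le> ?S"
    proof (rule ereal_le_epsilon2)
      fix e :: real assume "0 < e"
      then have "0 < e / 2" by simp
      then obtain U where U: "uniformly_distributed M U"
        "spectral_risk M \<sigma> Y \<le> (LINT \<omega>|M. Y \<omega> * truncated_spectrum \<sigma> (U \<omega>)) + 2 * (e / 2)"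
        by (rule ex_uniform_near_spectral_risk[OF \<sigma> Y V])
      then have "?R \<le> ereal (LINT \<omega>|M. Y \<omega> * truncated_spectrum \<sigma> (U \<omega>)) + ereal e" by simp
      also have "\<dots> \<le> ?S + ereal e"
        using U(1) by (intro add_right_mono SUP_upper) auto
      finally show "?R \<le> ?S + ereal e" .
    qed
    show "?S \<le> ?R"
      using integral_le_spectral_risk[OF \<sigma> Y spectrally_dominated_spectrum_uniform[OF \<sigma>]]
      by (intro SUP_least) auto
  qed
  show ?thesis
    unfolding set_integral_spectrum_eq
    using dual[unfolded spectrally_dominated_iff_dominated_by_spectrum[OF \<sigma>]]
      dual[unfolded spectrally_dominated_iff] uniform
      integral_comonotone_eq_spectral_risk[OF \<sigma> Y] by blast
qed

end
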